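(* Let $X$ and $Y$ be two real random variables with finite means and distribution functions $F$ and $G$, respectively, and let $p_0\in(0,1)$. If $$\max\{X,F^{-1}(p_0)\}\leq_{\mathrm{icx}}\max\{Y,G^{-1}(p_0)\},$$ then $X\leq_{p_0\text{-tvar}}Y$.
   Context: For a random variable $X$ with distribution function $F$, the quantile function is $F^{-1}(p)=\inf\{x: F(x)\geq p\}$ for $p\in(0,1)$, and the tail value at risk is $\mathrm{TVaR}_p(X)=\frac{1}{1-p}\int_p^1 F^{-1}(u)\,du$ for $p\in[0,1)$. For $p_0\in[0,1)$, $X\leq_{p_0\text{-tvar}}Y$ means that $\mathrm{TVaR}_p(X)\leq\mathrm{TVaR}_p(Y)$ for all $p\in(p_0,1)$. The increasing convex order $X\leq_{\mathrm{icx}}Y$ means $\mathrm{TVaR}_p(X)\leq\mathrm{TVaR}_p(Y)$ for all $p\in(0,1)$ (equivalently, $\mathrm{E}[(X-x)_+]\leq\mathrm{E}[(Y-x)_+]$ for all $x\in\mathbb R$, where $(x)_+=\max\{x,0\}$). *)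

theory Defs
  imports "HOL-Probability.Probability"
begin

text \<open>For a distribution function \<open>F\<close> and \<open>0 < p < 1\<close> the set below is nonempty and bounded
  below, so the conditionally complete \<^const>\<open>Inf\<close> on the reals is the genuine infimum. Outside
  of this range the value of \<open>quantile F p\<close> is unspecified.\<close>

definition quantile :: "(real \<Rightarrow> real) \<Rightarrow> real \<Rightarrow> real"
  where "quantile F p = Inf {x. F x \<ge> p}"

definition distr_fun :: "'a measure \<Rightarrow> ('a \<Rightarrow> real) \<Rightarrow> real \<Rightarrow> real"
  where "distr_fun M X = cdf (distr M borel X)"

text \<open>The integral is taken over the open interval, as the quantile function is only defined on
  \<open>(0,1)\<close>. When \<open>X\<close> has a finite mean the integrand is Lebesgue integrable there; otherwise
  the integral may take the library's default value 0, so the notions below are only meaningful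
  for integrable random variables.\<close>

definition tvar :: "'a measure \<Rightarrow> ('a \<Rightarrow> real) \<Rightarrow> real \<Rightarrow> real"
  where "tvar M X p = 1 / (1 - p) * (LBINT u:{p<..<1}. quantile (distr_fun M X) u)"

text \<open>The orders compare laws only, hence the two random variables may live on different
  probability spaces \<open>M\<close> and \<open>N\<close>.\<close>

definition tvar_le ::
    "real \<Rightarrow> 'a measure \<Rightarrow> ('a \<Rightarrow> real) \<Rightarrow> 'b measure \<Rightarrow> ('b \<Rightarrow> real) \<Rightarrow> bool"
  where "tvar_le p\<^sub>0 M X N Y \<longleftrightarrow> (\<forall>p\<in>{p\<^sub>0<..<1}. tvar M X p \<le> tvar N Y p)"

definition icx_le ::
    "'a measure \<Rightarrow> ('a \<Rightarrow> real) \<Rightarrow> 'b measure \<Rightarrow> ('b \<Rightarrow> real) \<Rightarrow> bool"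
  where "icx_le M X N Y \<longleftrightarrow> (\<forall>p\<in>{0<..<1}. tvar M X p \<le> tvar N Y p)"

end

theory Submission
  imports Defs
begin

text \<open>Truncating \<open>X\<close> from below at \<open>c = F\<inverse>(p\<^sub>0)\<close> moves all mass below \<open>c\<close> to
  the point \<open>c\<close>, so the distribution function becomes \<open>0\<close> below \<open>c\<close> and stays \<open>F\<close> from
  \<open>c\<close> on. A point at which \<open>F\<close> reaches a level \<open>u > p\<^sub>0\<close> is at least \<open>c\<close>, so
  the sets whose infima define the two quantiles at \<open>u\<close> coincide. Hence \<open>X\<close> and
  \<open>max X c\<close> have the same quantiles on \<open>(p\<^sub>0,1)\<close>, and therefore the same tail value at risk
  at every level above \<open>p\<^sub>0\<close>. The hypothesis at these levels is then the
  conclusion verbatim (\<open>tvar_max_quantile\<close>).\<close>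

lemma distr_fun_eq_prob:
  assumes "X \<in> borel_measurable M"
  shows "distr_fun M X x = measure M {\<omega> \<in> space M. X \<omega> \<le> x}"
proof -
  have "X -` {..x} \<inter> space M = {\<omega> \<in> space M. X \<omega> \<le> x}" by auto
  then show ?thesis
    using assms by (simp add: distr_fun_def cdf_def measure_distr)
qed

lemma distr_fun_max:
  assumes "X \<in> borel_measurable M"
  shows "distr_fun M (\<lambda>\<omega>. max (X \<omega>) c) x = (if x < c then 0 else distr_fun M X x)"
proof -
  have "(\<lambda>\<omega>. max (X \<omega>) c) \<in> borel_measurable M" using assms by measurable
  then show ?thesis
    using assms by (simp add: distr_fun_eq_prob)
qed

text \<open>Because \<^const>\<open>Inf\<close> on the reals is only conditionally complete, \<open>x\<close> dominates
  the infimum only once the superlevel set is known to be bounded below; this is where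
  \<open>F\<close> tending to \<open>0\<close> at \<open>-\<infinity>\<close> and \<open>p > 0\<close> enter.\<close>

lemma quantile_le:
  assumes "prob_space M" and "X \<in> borel_measurable M"
    and "0 < p" and "p \<le> distr_fun M X x"
  shows "quantile (distr_fun M X) p \<le> x"
proof -
  interpret D: real_distribution "distr M borel X"
    using assms(1,2) by (simp add: prob_space.real_distribution_distr)
  obtain b where b: "\<And>y. y \<le> b \<Longrightarrow> distr_fun M X y < p"
    using order_tendstoD(2)[OF D.cdf_lim_at_bot \<open>0 < p\<close>]
    by (auto simp: eventually_at_bot_linorder distr_fun_def)
  have "bdd_below {y. distr_fun M X y \<ge> p}"
  proof (rule bdd_belowI[of _ b])
    fix y assume "y \<in> {y. distr_fun M X y \<ge> p}"
    then show "b \<le> y" using b[of y] by (cases "b \<le> y") auto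
  qed
  then show ?thesis
    unfolding quantile_def using assms(4) by (intro cInf_lower) auto
qed

lemma quantile_max_quantile:
  assumes "prob_space M" and "X \<in> borel_measurable M" and "0 < p\<^sub>0" and "p\<^sub>0 \<le> u"
  shows "quantile (distr_fun M (\<lambda>\<omega>. max (X \<omega>) (quantile (distr_fun M X) p\<^sub>0))) u
    = quantile (distr_fun M X) u"
proof -
  let ?F = "distr_fun M X"
  have "quantile ?F p\<^sub>0 \<le> x" if "?F x \<ge> u" for x
    using quantile_le[OF assms(1-3)] that assms(4) by force
  then have "{x. distr_fun M (\<lambda>\<omega>. max (X \<omega>) (quantile ?F p\<^sub>0)) x \<ge> u} = {x. ?F x \<ge> u}"
    using assms by (force simp: distr_fun_max)
  then show ?thesis by (simp add: quantile_def)
qed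

lemma tvar_max_quantile:
  assumes "prob_space M" and "X \<in> borel_measurable M" and "0 < p\<^sub>0" and "p\<^sub>0 \<le> p"
  shows "tvar M (\<lambda>\<omega>. max (X \<omega>) (quantile (distr_fun M X) p\<^sub>0)) p = tvar M X p"
proof -
  have "(LBINT u:{p<..<1}.
        quantile (distr_fun M (\<lambda>\<omega>. max (X \<omega>) (quantile (distr_fun M X) p\<^sub>0))) u)
      = (LBINT u:{p<..<1}. quantile (distr_fun M X) u)"
    using assms by (intro set_lebesgue_integral_cong) (auto simp: quantile_max_quantile)
  then show ?thesis by (simp add: tvar_def)
qed

theorem proposition2p4:
  fixes M :: "'a measure" and N :: "'b measure"
    and X :: "'a \<Rightarrow> real" and Y :: "'b \<Rightarrow> real"
    and F G :: "real \<Rightarrow> real" and p\<^sub>0 :: real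
  assumes "prob_space M" and "prob_space N"
    and "integrable M X" and "integrable N Y"
    and "F = distr_fun M X" and "G = distr_fun N Y"
    and "p\<^sub>0 \<in> {0<..<1}"
    and "icx_le M (\<lambda>\<omega>. max (X \<omega>) (quantile F p\<^sub>0)) N (\<lambda>\<omega>. max (Y \<omega>) (quantile G p\<^sub>0))"
  shows "tvar_le p\<^sub>0 M X N Y"
  unfolding tvar_le_def
proof
  fix p assume p: "p \<in> {p\<^sub>0<..<1}"
  have "tvar M (\<lambda>\<omega>. max (X \<omega>) (quantile F p\<^sub>0)) p = tvar M X p"
    and "tvar N (\<lambda>\<omega>. max (Y \<omega>) (quantile G p\<^sub>0)) p = tvar N Y p"
    using assms(1-7) p by (auto intro!: tvar_max_quantile)
  moreover have "tvar M (\<lambda>\<omega>. max (X \<omega>) (quantile F p\<^sub>0)) p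
      \<le> tvar N (\<lambda>\<omega>. max (Y \<omega>) (quantile G p\<^sub>0)) p"
    using assms(7,8) p by (auto simp: icx_le_def)
  ultimately show "tvar M X p \<le> tvar N Y p" by simp
qed

end
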